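(* The solutions $\mathbf{E}^{t_{end}},\mathbf{H}^{t_{end}}$ of the fully discrete scheme defined in the context possess the discrete momentum conservation laws $$\mathcal{M}_1^{t_{end}}=\mathcal{M}_1^0,\qquad \mathcal{M}_2^{t_{end}}=\mathcal{M}_2^0,$$ where, for $k=1,2,3$, $$\mathcal{M}_1^t=\langle\mathbf{H}^t,\mathbf{B}_k\mathbf{E}^t\rangle_N,\qquad \mathcal{M}_2^t=\langle\mathbf{E}^t,\mathbf{B}_k\mathbf{H}^t\rangle_N,\qquad \mathbf{B}_k=\mathrm{diag}(\mathbf{D}_k,\mathbf{D}_k,\mathbf{D}_k),$$ and $\mathbf{D}_1=I_{N_z}\otimes I_{N_y}\otimes D_x$, $\mathbf{D}_2=I_{N_z}\otimes D_y\otimes I_{N_x}$, $\mathbf{D}_3=D_z\otimes I_{N_y}\otimes I_{N_x}$.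
   Context: **Setting.** $\varepsilon,\mu>0$ are constants. The scheme approximates Maxwell's equations $\partial_t\mathbf{H}=-\frac1\mu\mathbf{curl}\,\mathbf{E}$, $\partial_t\mathbf{E}=\frac1\varepsilon\mathbf{curl}\,\mathbf{H}$, $\nabla\cdot(\varepsilon\mathbf{E})=0$, $\nabla\cdot(\varepsilon\mathbf{H})=0$ for $\mathbb{R}^3$-valued $\mathbf{H}=(H_x,H_y,H_z)^\intercal$, $\mathbf{E}=(E_x,E_y,E_z)^\intercal$ on $\Omega\times[0,t_{end}]$, $\Omega=[x_L,x_R]\times[y_L,y_R]\times[z_L,z_R]$, with periodic boundary conditions and given initial values. **Grid.** For $w\in\{x,y,z\}$, $N_w$ is a positive even integer, $h_w=(w_R-w_L)/N_w$, $x_j=x_L+(j-1)h_x$, $y_k=y_L+(k-1)h_y$, $z_l=z_L+(l-1)h_z$ for $1\le j\le N_x$, $1\le k\le N_y$, $1\le l\le N_z$. A grid function is identified with the vector in $\mathbb{C}^{N_xN_yN_z}$ whose entry number $N_xN_y(l-1)+N_x(k-1)+j$ is its value at $(x_j,y_k,z_l)$. $I_m$ is the $m\times m$ identity and $\otimes$ the Kronecker product. $\langle u,v\rangle_N=\frac1{N_xN_yN_z}\sum_{j,k,l}u_{j,k,l}\overline{v_{j,k,l}}$, summed over the three components for vector fields. **Matrices.** $\nu_w=2\pi/(w_R-w_L)$. $D_w$ is the $N_w\times N_w$ spectral differentiation matrix with $(D_w)_{j,l}=\frac12\nu_w(-1)^{j+l}\cot(\nu_w(w_j-w_l)/2)$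 for $j\ne l$ and zero diagonal. $\mathcal{F}_{N_w}$ is the DFT matrix with entries $(e^{2\pi\mathrm{i}/N_w})^{-jk}$, $0\le j,k\le N_w-1$, and $\mathcal{F}_{N_w}^{-1}$ its inverse, with entries $\frac1{N_w}(e^{2\pi\mathrm{i}/N_w})^{jk}$. Put $\Omega_w=\nu_w\,\mathrm{diag}(0,1,\ldots,\frac{N_w}2-1,0,-\frac{N_w}2+1,\ldots,-2,-1)$, $\Omega_1=I_{N_z}\otimes I_{N_y}\otimes\Omega_x$, $\Omega_2=I_{N_z}\otimes\Omega_y\otimes I_{N_x}$, $\Omega_3=\Omega_z\otimes I_{N_y}\otimes I_{N_x}$. For $\tau\ge0$ put $\Psi=\tau^2(\Omega_1^2+\Omega_2^2+\Omega_3^2)$ and let $A=\frac{\cosh(\sqrt{-\Psi})-I}{\Psi}$, $B=\frac{\sinh(\sqrt{-\Psi})}{\sqrt{-\Psi}}$ be the diagonal matrices obtained entrywise (with the value by continuity, $-1/2$ and $1$ respectively, where the diagonal entry of $\Psi$ is $0$). Define $\mathbf{c}_{11}=I+\tau^2(\Omega_3^2+\Omega_2^2)A$, $\mathbf{c}_{22}=I+\tau^2(\Omega_3^2+\Omega_1^2)A$, $\mathbf{c}_{33}=I+\tau^2(\Omega_2^2+\Omega_1^2)A$, $\mathbf{c}_{12}=-\tau^2\Omega_2\Omega_1A$, $\mathbf{c}_{13}=-\tau^2\Omega_3\Omega_1A$, $\mathbf{c}_{23}=-\tau^2\Omega_3\Omega_2A$, $\mathbf{s}_{12}=\mathrm{i}\tau\Omega_3B$,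 $\mathbf{s}_{13}=\mathrm{i}\tau\Omega_2B$, $\mathbf{s}_{23}=\mathrm{i}\tau\Omega_1B$. **Fully discrete scheme.** Let $\mathbf{E}^0_w,\mathbf{H}^0_w$ be the (real) vectors of values of $E_w(\cdot,0),H_w(\cdot,0)$ at the grid points, and $\widehat{\mathbf{E}}^0_w=(\mathcal{F}_{N_z}\otimes\mathcal{F}_{N_y}\otimes\mathcal{F}_{N_x})\mathbf{E}^0_w$, $\widehat{\mathbf{H}}^0_w=(\mathcal{F}_{N_z}\otimes\mathcal{F}_{N_y}\otimes\mathcal{F}_{N_x})\mathbf{H}^0_w$. For a time $t\ge0$, with $\tau=t/\sqrt{\mu\varepsilon}$, $$\mathbf{c}=\begin{pmatrix}\mathbf{c}_{11}&\mathbf{c}_{12}&\mathbf{c}_{13}\\\mathbf{c}_{12}&\mathbf{c}_{22}&\mathbf{c}_{23}\\\mathbf{c}_{13}&\mathbf{c}_{23}&\mathbf{c}_{33}\end{pmatrix},\qquad \mathbf{s}=\begin{pmatrix}\mathbf{0}&-\mathbf{s}_{12}&\mathbf{s}_{13}\\\mathbf{s}_{12}&\mathbf{0}&-\mathbf{s}_{23}\\-\mathbf{s}_{13}&\mathbf{s}_{23}&\mathbf{0}\end{pmatrix},$$ and $\widehat{\mathbf{E}}=(\widehat{\mathbf{E}}_x,\widehat{\mathbf{E}}_y,\widehat{\mathbf{E}}_z)^\intercal$, $\widehat{\mathbf{H}}=(\widehat{\mathbf{H}}_x,\widehat{\mathbf{H}}_y,\widehat{\mathbf{H}}_z)^\intercal$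 (stacked), set $$\sqrt\mu\,\widehat{\mathbf{H}}^{t}=\sqrt\mu\,\mathbf{c}\,\widehat{\mathbf{H}}^0-\sqrt\varepsilon\,\mathbf{s}\,\widehat{\mathbf{E}}^0,\qquad \sqrt\varepsilon\,\widehat{\mathbf{E}}^{t}=\sqrt\varepsilon\,\mathbf{c}\,\widehat{\mathbf{E}}^0+\sqrt\mu\,\mathbf{s}\,\widehat{\mathbf{H}}^0,$$ $\mathbf{E}^{t}_w=(\mathcal{F}^{-1}_{N_z}\otimes\mathcal{F}^{-1}_{N_y}\otimes\mathcal{F}^{-1}_{N_x})\widehat{\mathbf{E}}^{t}_w$, $\mathbf{H}^{t}_w=(\mathcal{F}^{-1}_{N_z}\otimes\mathcal{F}^{-1}_{N_y}\otimes\mathcal{F}^{-1}_{N_x})\widehat{\mathbf{H}}^{t}_w$ for $w=x,y,z$, and $\mathbf{E}^t=(\mathbf{E}^t_x,\mathbf{E}^t_y,\mathbf{E}^t_z)^\intercal$, $\mathbf{H}^t=(\mathbf{H}^t_x,\mathbf{H}^t_y,\mathbf{H}^t_z)^\intercal$. The scheme's output is the case $t=t_{end}$. *)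

theory Defs
  imports Complex_Main "Jordan_Normal_Form.Matrix"
begin

section \<open>Grid\<close>

datatype axis = X_axis | Y_axis | Z_axis

text \<open>The box is the product of the intervals \<open>[box_left G w, box_right G w]\<close>, with
  \<open>num_pts G w\<close> grid points along the axis \<open>w\<close>.\<close>

record grid =
  box_left :: "axis \<Rightarrow> real"
  box_right :: "axis \<Rightarrow> real"
  num_pts :: "axis \<Rightarrow> nat"

definition mesh_size :: "grid \<Rightarrow> axis \<Rightarrow> real" where
  "mesh_size G w = (box_right G w - box_left G w) / real (num_pts G w)"

text \<open>All indices are 0-based: \<open>node G w j\<close> is the point with 1-based index \<open>j + 1\<close>.\<close>

definition node :: "grid \<Rightarrow> axis \<Rightarrow> nat \<Rightarrow> real" where
  "node G w j = box_left G w + real j * mesh_size G w"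

definition total_pts :: "grid \<Rightarrow> nat" where
  "total_pts G = num_pts G X_axis * num_pts G Y_axis * num_pts G Z_axis"

text \<open>Entry number \<open>N\<^sub>x * N\<^sub>y * l + N\<^sub>x * k + j\<close> is the value at the node \<open>(j, k, l)\<close>.\<close>

definition grid_vec :: "grid \<Rightarrow> (real \<times> real \<times> real \<Rightarrow> real) \<Rightarrow> complex vec" where
  "grid_vec G f = vec (total_pts G) (\<lambda>i.
     let Nx = num_pts G X_axis; Ny = num_pts G Y_axis;
         j = i mod Nx; k = (i div Nx) mod Ny; l = i div (Nx * Ny)
     in complex_of_real (f (node G X_axis j, node G Y_axis k, node G Z_axis l)))"

section \<open>Vector fields and block matrices\<close>

text \<open>A stacked vector is given by its three components, and a 3 by 3 block matrix by its
  nine blocks.\<close>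

type_synonym vfield = "axis \<Rightarrow> complex vec"
type_synonym block_mat = "axis \<Rightarrow> axis \<Rightarrow> complex mat"

definition block_mult_vec :: "block_mat \<Rightarrow> vfield \<Rightarrow> vfield" (infixl \<open>*\<^sub>b\<close> 70) where
  "M *\<^sub>b u = (\<lambda>v. M v X_axis *\<^sub>v u X_axis + M v Y_axis *\<^sub>v u Y_axis + M v Z_axis *\<^sub>v u Z_axis)"

definition block_diag :: "grid \<Rightarrow> complex mat \<Rightarrow> block_mat" where
  "block_diag G M = (\<lambda>v w. if v = w then M else 0\<^sub>m (total_pts G) (total_pts G))"

definition inner_N :: "grid \<Rightarrow> vfield \<Rightarrow> vfield \<Rightarrow> complex" where
  "inner_N G u v =
     1 / of_nat (total_pts G) * (\<Sum>w\<in>{X_axis, Y_axis, Z_axis}. u w \<bullet>c v w)"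

section \<open>Kronecker products\<close>

definition kron :: "'a :: semiring_0 mat \<Rightarrow> 'a mat \<Rightarrow> 'a mat" (infixr \<open>\<otimes>\<^sub>K\<close> 72) where
  "A \<otimes>\<^sub>K B = mat (dim_row A * dim_row B) (dim_col A * dim_col B)
     (\<lambda>(i, j). A $$ (i div dim_row B, j div dim_col B) * B $$ (i mod dim_row B, j mod dim_col B))"

text \<open>The operator acting as \<open>M\<close> along one axis and as the identity along the other two.\<close>

fun along_axis :: "grid \<Rightarrow> axis \<Rightarrow> complex mat \<Rightarrow> complex mat" where
  "along_axis G X_axis M = 1\<^sub>m (num_pts G Z_axis) \<otimes>\<^sub>K 1\<^sub>m (num_pts G Y_axis) \<otimes>\<^sub>K M"
| "along_axis G Y_axis M = 1\<^sub>m (num_pts G Z_axis) \<otimes>\<^sub>K M \<otimes>\<^sub>K 1\<^sub>m (num_pts G X_axis)"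
| "along_axis G Z_axis M = M \<otimes>\<^sub>K 1\<^sub>m (num_pts G Y_axis) \<otimes>\<^sub>K 1\<^sub>m (num_pts G X_axis)"

section \<open>Spectral differentiation and discrete Fourier transform\<close>

definition nu :: "grid \<Rightarrow> axis \<Rightarrow> real" where
  "nu G w = 2 * pi / (box_right G w - box_left G w)"

definition spectral_diff :: "grid \<Rightarrow> axis \<Rightarrow> complex mat" where
  "spectral_diff G w = mat (num_pts G w) (num_pts G w) (\<lambda>(j, l).
     if j = l then 0
     else complex_of_real
       (1/2 * nu G w * (-1) ^ (j + l) * cot (nu G w * (node G w j - node G w l) / 2)))"

definition diff_op :: "grid \<Rightarrow> axis \<Rightarrow> complex mat" where
  "diff_op G k = along_axis G k (spectral_diff G k)"

definition unit_root :: "nat \<Rightarrow> complex" where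
  "unit_root n = exp (2 * of_real pi * \<i> / of_nat n)"

definition dft :: "nat \<Rightarrow> complex mat" where
  "dft n = mat n n (\<lambda>(j, k). unit_root n powi (- int (j * k)))"

definition idft :: "nat \<Rightarrow> complex mat" where
  "idft n = mat n n (\<lambda>(j, k). 1 / of_nat n * unit_root n ^ (j * k))"

definition dft3 :: "grid \<Rightarrow> complex mat" where
  "dft3 G = dft (num_pts G Z_axis) \<otimes>\<^sub>K dft (num_pts G Y_axis) \<otimes>\<^sub>K dft (num_pts G X_axis)"

definition idft3 :: "grid \<Rightarrow> complex mat" where
  "idft3 G = idft (num_pts G Z_axis) \<otimes>\<^sub>K idft (num_pts G Y_axis) \<otimes>\<^sub>K idft (num_pts G X_axis)"

section \<open>The propagator in Fourier space\<close>

text \<open>The wave numbers \<open>0, 1, \<dots>, n/2 - 1, 0, -n/2 + 1, \<dots>, -2, -1\<close> for even \<open>n\<close>.\<close>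

definition wave_number :: "nat \<Rightarrow> nat \<Rightarrow> int" where
  "wave_number n j =
     (if j < n div 2 then int j else if j = n div 2 then 0 else int j - int n)"

definition freq_diag :: "grid \<Rightarrow> axis \<Rightarrow> complex mat" where
  "freq_diag G w = mat_diag (num_pts G w)
     (\<lambda>j. complex_of_real (nu G w * of_int (wave_number (num_pts G w) j)))"

definition freq :: "grid \<Rightarrow> axis \<Rightarrow> complex mat" where
  "freq G w = along_axis G w (freq_diag G w)"

definition Psi :: "grid \<Rightarrow> real \<Rightarrow> complex mat" where
  "Psi G \<tau> = complex_of_real (\<tau>\<^sup>2) \<cdot>\<^sub>m
     (freq G X_axis ^\<^sub>m 2 + freq G Y_axis ^\<^sub>m 2 + freq G Z_axis ^\<^sub>m 2)"

text \<open>The diagonal of \<open>Psi\<close> is nonnegative, so the square roots below are those of nonpositive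
  numbers and have to be complex.\<close>

definition A_mat :: "grid \<Rightarrow> real \<Rightarrow> complex mat" where
  "A_mat G \<tau> = mat_diag (total_pts G) (\<lambda>i. let \<psi> = Psi G \<tau> $$ (i, i) in
     if \<psi> = 0 then - (1/2) else (cosh (csqrt (- \<psi>)) - 1) / \<psi>)"

definition B_mat :: "grid \<Rightarrow> real \<Rightarrow> complex mat" where
  "B_mat G \<tau> = mat_diag (total_pts G) (\<lambda>i. let \<psi> = Psi G \<tau> $$ (i, i) in
     if \<psi> = 0 then 1 else sinh (csqrt (- \<psi>)) / csqrt (- \<psi>))"

definition c_diag :: "grid \<Rightarrow> real \<Rightarrow> axis \<Rightarrow> axis \<Rightarrow> complex mat" where
  "c_diag G \<tau> v w = 1\<^sub>m (total_pts G) +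
     complex_of_real (\<tau>\<^sup>2) \<cdot>\<^sub>m ((freq G v ^\<^sub>m 2 + freq G w ^\<^sub>m 2) * A_mat G \<tau>)"

definition c_off :: "grid \<Rightarrow> real \<Rightarrow> axis \<Rightarrow> axis \<Rightarrow> complex mat" where
  "c_off G \<tau> v w =
     complex_of_real (- (\<tau>\<^sup>2)) \<cdot>\<^sub>m (freq G v * freq G w * A_mat G \<tau>)"

definition s_off :: "grid \<Rightarrow> real \<Rightarrow> axis \<Rightarrow> complex mat" where
  "s_off G \<tau> w = (\<i> * complex_of_real \<tau>) \<cdot>\<^sub>m (freq G w * B_mat G \<tau>)"

fun c_mat :: "grid \<Rightarrow> real \<Rightarrow> block_mat" where
  "c_mat G \<tau> X_axis X_axis = c_diag G \<tau> Z_axis Y_axis"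
| "c_mat G \<tau> X_axis Y_axis = c_off G \<tau> Y_axis X_axis"
| "c_mat G \<tau> X_axis Z_axis = c_off G \<tau> Z_axis X_axis"
| "c_mat G \<tau> Y_axis X_axis = c_off G \<tau> Y_axis X_axis"
| "c_mat G \<tau> Y_axis Y_axis = c_diag G \<tau> Z_axis X_axis"
| "c_mat G \<tau> Y_axis Z_axis = c_off G \<tau> Z_axis Y_axis"
| "c_mat G \<tau> Z_axis X_axis = c_off G \<tau> Z_axis X_axis"
| "c_mat G \<tau> Z_axis Y_axis = c_off G \<tau> Z_axis Y_axis"
| "c_mat G \<tau> Z_axis Z_axis = c_diag G \<tau> Y_axis X_axis"

fun s_mat :: "grid \<Rightarrow> real \<Rightarrow> block_mat" where
  "s_mat G \<tau> X_axis X_axis = 0\<^sub>m (total_pts G) (total_pts G)"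
| "s_mat G \<tau> X_axis Y_axis = - s_off G \<tau> Z_axis"
| "s_mat G \<tau> X_axis Z_axis = s_off G \<tau> Y_axis"
| "s_mat G \<tau> Y_axis X_axis = s_off G \<tau> Z_axis"
| "s_mat G \<tau> Y_axis Y_axis = 0\<^sub>m (total_pts G) (total_pts G)"
| "s_mat G \<tau> Y_axis Z_axis = - s_off G \<tau> X_axis"
| "s_mat G \<tau> Z_axis X_axis = - s_off G \<tau> Y_axis"
| "s_mat G \<tau> Z_axis Y_axis = s_off G \<tau> X_axis"
| "s_mat G \<tau> Z_axis Z_axis = 0\<^sub>m (total_pts G) (total_pts G)"

section \<open>The fully discrete scheme\<close>

text \<open>In the two equations defining the Fourier coefficients at time \<open>t\<close>, the factors
  \<open>sqrt \<mu>\<close> and \<open>sqrt \<epsilon>\<close> on the left-hand sides are divided out.\<close>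

definition scheme_H ::
  "grid \<Rightarrow> real \<Rightarrow> real \<Rightarrow> vfield \<Rightarrow> vfield \<Rightarrow> real \<Rightarrow> vfield" where
  "scheme_H G \<epsilon> \<mu> E0 H0 t = (\<lambda>w.
     let \<tau> = t / sqrt (\<mu> * \<epsilon>);
         Eh = (\<lambda>v. dft3 G *\<^sub>v E0 v); Hh = (\<lambda>v. dft3 G *\<^sub>v H0 v)
     in idft3 G *\<^sub>v (complex_of_real (1 / sqrt \<mu>) \<cdot>\<^sub>v
          (complex_of_real (sqrt \<mu>) \<cdot>\<^sub>v (c_mat G \<tau> *\<^sub>b Hh) w
           - complex_of_real (sqrt \<epsilon>) \<cdot>\<^sub>v (s_mat G \<tau> *\<^sub>b Eh) w)))"

definition scheme_E ::
  "grid \<Rightarrow> real \<Rightarrow> real \<Rightarrow> vfield \<Rightarrow> vfield \<Rightarrow> real \<Rightarrow> vfield" where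
  "scheme_E G \<epsilon> \<mu> E0 H0 t = (\<lambda>w.
     let \<tau> = t / sqrt (\<mu> * \<epsilon>);
         Eh = (\<lambda>v. dft3 G *\<^sub>v E0 v); Hh = (\<lambda>v. dft3 G *\<^sub>v H0 v)
     in idft3 G *\<^sub>v (complex_of_real (1 / sqrt \<epsilon>) \<cdot>\<^sub>v
          (complex_of_real (sqrt \<epsilon>) \<cdot>\<^sub>v (c_mat G \<tau> *\<^sub>b Eh) w
           + complex_of_real (sqrt \<mu>) \<cdot>\<^sub>v (s_mat G \<tau> *\<^sub>b Hh) w)))"

section \<open>Discrete momentum\<close>

definition momentum1 :: "grid \<Rightarrow> axis \<Rightarrow> vfield \<Rightarrow> vfield \<Rightarrow> complex" where
  "momentum1 G k E H = inner_N G H (block_diag G (diff_op G k) *\<^sub>b E)"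

definition momentum2 :: "grid \<Rightarrow> axis \<Rightarrow> vfield \<Rightarrow> vfield \<Rightarrow> complex" where
  "momentum2 G k E H = inner_N G E (block_diag G (diff_op G k) *\<^sub>b H)"

end

theory Submission
  imports Defs "Jordan_Normal_Form.Determinant"
begin

text \<open>In Fourier space \<open>diff_op G k\<close> becomes multiplication by \<open>\<i> \<omega>\<^sub>k\<close>, and by Parseval the
  momentum is, up to a constant, the sum over the modes \<open>p\<close> of \<open>\<omega>\<^sub>k(p)\<close> times the Hermitian
  product of the two fields at \<open>p\<close>. The fields are real, so this product is conjugated by
  the reflection \<open>p \<mapsto> - p\<close>, while \<open>\<omega>\<^sub>k\<close> is odd, also at the Nyquist index where it vanishes;
  hence only the imaginary part of the product contributes to the sum. This imaginary part is
  conserved mode by mode, because the blocks \<open>c\<close> and \<open>s\<close> of the propagator and their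
  product \<open>c s\<close> are Hermitian and \<open>c\<^sup>2 + s\<^sup>2 = 1\<close>.\<close>

section \<open>Kronecker products and diagonal matrices\<close>

text \<open>Quotient and remainder by \<open>n\<close> are a bijection from flat indices to index
  pairs. This splits the inner sum in a product of Kronecker products.\<close>

lemma sum_div_mod:
  fixes f :: "nat \<Rightarrow> nat \<Rightarrow> 'a :: comm_monoid_add"
  shows "(\<Sum>x<m * n. f (x div n) (x mod n)) = (\<Sum>i<m. \<Sum>j<n. f i j)"
proof -
  have "(\<Sum>x<m * n. f (x div n) (x mod n)) = (\<Sum>(i, j)\<in>{..<m} \<times> {..<n}. f i j)"
  proof (rule sum.reindex_bij_witness[of _ "\<lambda>(i, j). i * n + j" "\<lambda>x. (x div n, x mod n)"])
    fix x assume x: "x \<in> {..<m * n}"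
    then have "n > 0" by (auto intro: gr0I)
    with x show "(x div n, x mod n) \<in> {..<m} \<times> {..<n}" by (simp add: less_mult_imp_div_less)
  next
    fix y assume "y \<in> {..<m} \<times> {..<n}"
    then show "(case y of (i, j) \<Rightarrow> i * n + j) \<in> {..<m * n}"
      by (auto simp: div_less_iff_less_mult[symmetric])
  qed auto
  then show ?thesis by (simp add: sum.cartesian_product)
qed

lemma dim_kron [simp]:
  "dim_row (A \<otimes>\<^sub>K B) = dim_row A * dim_row B" "dim_col (A \<otimes>\<^sub>K B) = dim_col A * dim_col B"
  by (simp_all add: kron_def)

lemma index_kron:
  "i < dim_row A * dim_row B \<Longrightarrow> j < dim_col A * dim_col B \<Longrightarrow> (A \<otimes>\<^sub>K B) $$ (i, j) =
    A $$ (i div dim_row B, j div dim_col B) * B $$ (i mod dim_row B, j mod dim_col B)"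
  by (simp add: kron_def)

text \<open>The mixed-product rule: once the flat summation index is split, commutativity moves the
  entries of \<open>B\<close> past those of \<open>C\<close> and the double sum factors.\<close>

lemma kron_mult:
  fixes A B C D :: "'a :: comm_semiring_0 mat"
  assumes "dim_col A = dim_row C" "dim_col B = dim_row D"
  shows "(A \<otimes>\<^sub>K B) * (C \<otimes>\<^sub>K D) = (A * C) \<otimes>\<^sub>K (B * D)"
proof (rule eq_matI)
  fix i j assume "i < dim_row ((A * C) \<otimes>\<^sub>K (B * D))" "j < dim_col ((A * C) \<otimes>\<^sub>K (B * D))"
  then have ij: "i < dim_row A * dim_row B" "j < dim_col C * dim_col D" by simp_all
  then have pos: "dim_row B > 0" "dim_col D > 0" by (auto intro: gr0I)
  note less = less_mult_imp_div_less[OF ij(1)] less_mult_imp_div_less[OF ij(2)]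
    mod_less_divisor[OF pos(1)] mod_less_divisor[OF pos(2)]
  have "((A \<otimes>\<^sub>K B) * (C \<otimes>\<^sub>K D)) $$ (i, j) = (\<Sum>x<dim_row C * dim_row D.
      (A $$ (i div dim_row B, x div dim_row D) * B $$ (i mod dim_row B, x mod dim_row D)) *
      (C $$ (x div dim_row D, j div dim_col D) * D $$ (x mod dim_row D, j mod dim_col D)))"
    using ij assms by (simp add: scalar_prod_def index_kron lessThan_atLeast0)
  also have "\<dots> = (\<Sum>y<dim_row C. \<Sum>z<dim_row D.
      (A $$ (i div dim_row B, y) * B $$ (i mod dim_row B, z)) *
      (C $$ (y, j div dim_col D) * D $$ (z, j mod dim_col D)))"
    by (rule sum_div_mod)
  also have "\<dots> = (\<Sum>y<dim_row C. A $$ (i div dim_row B, y) * C $$ (y, j div dim_col D)) *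
      (\<Sum>z<dim_row D. B $$ (i mod dim_row B, z) * D $$ (z, j mod dim_col D))"
    by (simp add: sum_product mult_ac)
  also have "\<dots> = ((A * C) \<otimes>\<^sub>K (B * D)) $$ (i, j)"
    using ij less assms by (simp add: index_kron scalar_prod_def lessThan_atLeast0)
  finally show "((A \<otimes>\<^sub>K B) * (C \<otimes>\<^sub>K D)) $$ (i, j) = ((A * C) \<otimes>\<^sub>K (B * D)) $$ (i, j)" .
qed simp_all

lemma kron_one: "1\<^sub>m m \<otimes>\<^sub>K 1\<^sub>m n = (1\<^sub>m (m * n) :: 'a :: semiring_1 mat)"
proof (rule eq_matI)
  fix i j assume "i < dim_row (1\<^sub>m (m * n) :: 'a mat)" "j < dim_col (1\<^sub>m (m * n) :: 'a mat)"
  then have ij: "i < m * n" "j < m * n" by simp_all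
  then have "n > 0" by (auto intro: gr0I)
  with ij show "(1\<^sub>m m \<otimes>\<^sub>K 1\<^sub>m n) $$ (i, j) = (1\<^sub>m (m * n) :: 'a mat) $$ (i, j)"
    by (auto simp: index_kron less_mult_imp_div_less) (metis div_mult_mod_eq)+
qed simp_all

lemma kron_mat_diag:
  fixes f g :: "nat \<Rightarrow> 'a :: semiring_0"
  shows "mat_diag m f \<otimes>\<^sub>K mat_diag n g = mat_diag (m * n) (\<lambda>i. f (i div n) * g (i mod n))"
proof (rule eq_matI)
  fix i j assume "i < dim_row (mat_diag (m * n) (\<lambda>i. f (i div n) * g (i mod n)))"
    "j < dim_col (mat_diag (m * n) (\<lambda>i. f (i div n) * g (i mod n)))"
  then have ij: "i < m * n" "j < m * n" by (simp_all add: mat_diag_def)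
  then have "n > 0" by (auto intro: gr0I)
  moreover have "i = j" if "i div n = j div n" "i mod n = j mod n"
    using that by (metis div_mult_mod_eq)
  ultimately show "(mat_diag m f \<otimes>\<^sub>K mat_diag n g) $$ (i, j)
      = mat_diag (m * n) (\<lambda>i. f (i div n) * g (i mod n)) $$ (i, j)"
    using ij by (auto simp: index_kron mat_diag_def less_mult_imp_div_less)
qed (simp_all add: mat_diag_def)

lemma mat_diag_add: "mat_diag n f + mat_diag n g = mat_diag n (\<lambda>i. f i + g i)"
  for f g :: "nat \<Rightarrow> 'a :: monoid_add"
  by (rule eq_matI) (simp_all add: mat_diag_def)

lemma mat_diag_smult: "x \<cdot>\<^sub>m mat_diag n f = mat_diag n (\<lambda>i. x * f i)"
  for f :: "nat \<Rightarrow> 'a :: mult_zero"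
  by (rule eq_matI) (simp_all add: mat_diag_def)

lemma mat_diag_uminus: "- mat_diag n f = mat_diag n (\<lambda>i. - f i)"
  for f :: "nat \<Rightarrow> 'a :: group_add"
  by (rule eq_matI) (simp_all add: mat_diag_def)

lemma mat_diag_square: "mat_diag n f ^\<^sub>m 2 = mat_diag n (\<lambda>i. f i * f i)"
  for f :: "nat \<Rightarrow> 'a :: semiring_1"
  by (simp add: numeral_2_eq_2 carrier_matD[OF mat_diag_dim])

lemma mat_diag_zero: "0\<^sub>m n n = mat_diag n (\<lambda>_. 0)"
  by (rule eq_matI) (simp_all add: mat_diag_def)

lemmas mat_diag_simps = mat_diag_add mat_diag_smult mat_diag_uminus mat_diag_square
  mat_diag_zero mat_diag_one[symmetric]

lemma mat_diag_mult_vec: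
  "v \<in> carrier_vec n \<Longrightarrow> mat_diag n f *\<^sub>v v = vec n (\<lambda>i. f i * v $ i)"
  by (intro eq_vecI) (simp_all add: mat_diag_def scalar_prod_def if_distrib if_distribR cong: if_cong)

section \<open>Fourier diagonalization of the spectral derivative\<close>

lemma unit_root_power_eq_1: "n > 0 \<Longrightarrow> unit_root n ^ n = 1"
  by (simp add: unit_root_def flip: exp_of_nat_mult)

lemma unit_root_nonzero [simp]: "unit_root n \<noteq> 0"
  by (simp add: unit_root_def)

lemma unit_root_eq_cis: "unit_root n = cis (2 * pi / of_nat n)"
  by (simp add: unit_root_def cis_conv_exp mult_ac)

lemma cnj_unit_root: "cnj (unit_root n) = inverse (unit_root n)"
  by (simp add: unit_root_eq_cis cis_cnj)

lemma unit_root_powi: "unit_root n powi m = cis (2 * pi * of_int m / of_nat n)"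
  unfolding unit_root_eq_cis cis_power_int by (simp add: mult_ac)

lemma unit_root_powi_eq_1_iff: "n > 0 \<Longrightarrow> unit_root n powi m = 1 \<longleftrightarrow> int n dvd m"
proof
  assume n: "n > 0" and "unit_root n powi m = 1"
  then have "cos (2 * pi * of_int m / of_nat n) = 1"
    by (simp add: unit_root_powi complex_eq_iff)
  then obtain k where "2 * pi * of_int m / of_nat n = of_int k * 2 * pi"
    using cos_one_2pi_int by blast
  then have "real_of_int m = of_int (k * int n)" using n by (simp add: field_simps)
  then show "int n dvd m" by (simp only: of_int_eq_iff) simp
next
  assume n: "n > 0" and "int n dvd m"
  then obtain k where "m = int n * k" by blast
  with n show "unit_root n powi m = 1"
    by (simp add: unit_root_power_eq_1 power_int_mult)
qed

text \<open>Orthogonality of characters: either all terms are 1, or the sum is geometric with a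
  ratio \<open>?z\<close> that differs from 1 and satisfies \<open>?z ^ n = 1\<close>.\<close>

lemma sum_unit_root_powi:
  assumes "n > 0"
  shows "(\<Sum>k<n. unit_root n powi (m * int k)) = (if int n dvd m then of_nat n else 0)"
proof (cases "int n dvd m")
  case True
  then have "unit_root n powi (m * int k) = 1" for k
    using assms by (simp add: unit_root_powi_eq_1_iff)
  with True show ?thesis by simp
next
  case False
  let ?z = "unit_root n powi m"
  have "?z \<noteq> 1" using False assms by (simp add: unit_root_powi_eq_1_iff)
  moreover have "?z ^ n = 1"
    using unit_root_powi_eq_1_iff[of n "m * int n"] assms by (simp add: power_int_mult)
  ultimately have "(\<Sum>k<n. ?z ^ k) = 0" by (simp add: sum_gp_strict)
  with False show ?thesis by (simp add: power_int_mult)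
qed

lemma int_dvd_diff_iff:
  assumes "i < n" "j < (n :: nat)"
  shows "int n dvd int i - int j \<longleftrightarrow> i = j"
  using assms by (metis mod_eq_dvd_iff mod_less of_nat_eq_iff of_nat_mod)

section \<open>The DFT matrix, wave numbers and the cotangent formula\<close>

lemma dim_dft [simp]: "dim_row (dft n) = n" "dim_col (dft n) = n"
  and dim_idft [simp]: "dim_row (idft n) = n" "dim_col (idft n) = n"
  by (simp_all add: dft_def idft_def)

lemma carrier_dft [simp]: "dft n \<in> carrier_mat n n" "idft n \<in> carrier_mat n n"
  by (auto intro!: carrier_matI)

lemma dft_mult_idft:
  assumes "n > 0"
  shows "dft n * idft n = 1\<^sub>m n"
proof (rule eq_matI)
  fix i j assume "i < dim_row (1\<^sub>m n :: complex mat)" "j < dim_col (1\<^sub>m n :: complex mat)"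
  then have ij: "i < n" "j < n" by simp_all
  then have "(dft n * idft n) $$ (i, j)
      = (\<Sum>k<n. 1 / of_nat n * unit_root n powi ((int j - int i) * int k))"
    by (simp add: scalar_prod_def dft_def idft_def lessThan_atLeast0 power_int_diff
        left_diff_distrib power_int_minus power_int_of_nat field_simps flip: of_nat_mult)
  also have "\<dots> = (1\<^sub>m n) $$ (i, j)"
    unfolding sum_distrib_left[symmetric] sum_unit_root_powi[OF assms]
    using ij assms by (auto simp: int_dvd_diff_iff)
  finally show "(dft n * idft n) $$ (i, j) = (1\<^sub>m n) $$ (i, j)" .
qed simp_all

text \<open>Summation by parts, multiplied through by \<open>z - 1\<close> to avoid a division. For
  a nontrivial \<open>n\<close>-th root of unity the right side collapses to
  \<open>n\<close>.\<close>

lemma sum_of_nat_times_power: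
  fixes z :: "'a :: comm_ring_1"
  shows "(z - 1) * (\<Sum>k<n. of_nat k * z ^ k) = of_nat n * z ^ n - z * (\<Sum>k<n. z ^ k)"
  by (induction n) (simp_all add: algebra_simps)

text \<open>\<open>wave_number n k\<close> is \<open>k\<close>, lowered by \<open>h\<close> at the
  Nyquist index \<open>h\<close> and by \<open>n\<close> beyond it. The three resulting parts have
  closed forms, and the correction at \<open>h\<close> is what produces the symmetric factor
  \<open>z + 1\<close>.\<close>

lemma sum_wave_number_times_power:
  fixes z :: complex
  assumes n: "n = 2 * h" "h > 0" and z: "z ^ n = 1" "z \<noteq> 1"
  shows "(z - 1) * (\<Sum>k<n. of_int (wave_number n k) * z ^ k) = of_nat h * z ^ h * (z + 1)"
proof -
  have eq: "of_int (wave_number n k) * z ^ k =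
      of_nat k * z ^ k - (if k = h then of_nat h * z ^ h else 0)
        - (if k \<in> {Suc h..<n} then of_nat n * z ^ k else 0)" if "k < n" for k
    using that n by (auto simp: wave_number_def algebra_simps)
  have split: "(\<Sum>k<n. of_int (wave_number n k) * z ^ k) =
      (\<Sum>k<n. of_nat k * z ^ k) - of_nat h * z ^ h - of_nat n * (\<Sum>k = Suc h..<n. z ^ k)"
  proof -
    have "(\<Sum>k<n. if k \<in> {Suc h..<n} then of_nat n * z ^ k else 0) = (\<Sum>k = Suc h..<n. of_nat n * z ^ k)"
      by (rule sum.mono_neutral_cong_right) auto
    moreover have "h < n" using n by simp
    moreover have "(\<Sum>k<n. of_int (wave_number n k) * z ^ k) = (\<Sum>k<n. of_nat k * z ^ k
        - (if k = h then of_nat h * z ^ h else 0)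
        - (if k \<in> {Suc h..<n} then of_nat n * z ^ k else 0))"
      by (rule sum.cong) (simp_all only: lessThan_iff eq)
    ultimately show ?thesis
      by (simp add: sum_subtractf sum_distrib_left)
  qed
  have lin: "(z - 1) * (\<Sum>k<n. of_nat k * z ^ k) = of_nat n"
    using z by (simp add: sum_of_nat_times_power sum_gp_strict)
  \<comment> \<open>The sum telescopes to \<open>z ^ n - z ^ Suc h\<close>.\<close>
  have geom: "(z - 1) * (\<Sum>k = Suc h..<n. z ^ k) = 1 - z ^ Suc h"
    using sum_Suc_diff'[of "Suc h" n "\<lambda>k. z ^ k"] n z
    by (simp add: sum_distrib_left algebra_simps)
  have "(z - 1) * (\<Sum>k<n. of_int (wave_number n k) * z ^ k) =
      (z - 1) * (\<Sum>k<n. of_nat k * z ^ k) - of_nat h * z ^ h * (z - 1)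
        - of_nat n * ((z - 1) * (\<Sum>k = Suc h..<n. z ^ k))"
    unfolding split by (simp add: right_diff_distrib mult_ac)
  also have "\<dots> = of_nat h * z ^ h * (z + 1)"
    unfolding lin geom using n by (simp add: algebra_simps)
  finally show ?thesis .
qed

text \<open>Negation modulo \<open>n\<close> on the residues \<open>j < n\<close>; the outer
  \<open>mod\<close> acts only at \<open>j = 0\<close>.\<close>

definition neg_mod :: "nat \<Rightarrow> nat \<Rightarrow> nat" where
  "neg_mod n j = (n - j) mod n"

lemma neg_mod_less: "n > 0 \<Longrightarrow> neg_mod n j < n"
  by (simp add: neg_mod_def)

lemma neg_mod_neg_mod: "j < n \<Longrightarrow> neg_mod n (neg_mod n j) = j"
  by (cases "j = 0") (simp_all add: neg_mod_def)

text \<open>\<open>neg_mod\<close> fixes \<open>0\<close> and \<open>n div 2\<close>, so oddness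
  forces the value 0 at both; hence the 0 at the Nyquist index in
  \<open>wave_number\<close>.\<close>

lemma wave_number_neg_mod:
  "even n \<Longrightarrow> j < n \<Longrightarrow> wave_number n (neg_mod n j) = - wave_number n j"
  by (cases "j = 0") (auto simp: neg_mod_def wave_number_def elim!: evenE)

text \<open>Gives the zero diagonal of \<open>spectral_diff\<close>, where the powers all have base
  1 and the closed form does not apply.\<close>

lemma sum_wave_number:
  assumes "even n"
  shows "(\<Sum>k<n. wave_number n k) = 0"
proof -
  have "(\<Sum>k<n. wave_number n k) = (\<Sum>k<n. - wave_number n k)"
    by (rule sum.reindex_bij_witness[of _ "neg_mod n" "neg_mod n"])
      (simp_all add: neg_mod_less neg_mod_neg_mod wave_number_neg_mod assms)
  then show ?thesis by (simp add: sum_negf)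
qed

lemma idft_mult_dft: "n > 0 \<Longrightarrow> idft n * dft n = 1\<^sub>m n"
  using dft_mult_idft by (rule mat_mult_left_right_inverse[rotated 2]) (auto intro!: carrier_matI)

text \<open>Pulling out the phase \<open>cis (\<theta> / 2)\<close> leaves a multiple of the sine in
  \<open>cis \<theta> - 1\<close> and of the cosine in \<open>cis \<theta> + 1\<close>.\<close>

lemma cot_half_cis:
  assumes "cis \<theta> \<noteq> 1"
  shows "(cis \<theta> - 1) * of_real (cot (\<theta> / 2)) = \<i> * (cis \<theta> + 1)"
proof -
  have sq: "cis \<theta> = cis (\<theta> / 2) * cis (\<theta> / 2)" by (simp add: cis_mult)
  have one: "1 = cis (\<theta> / 2) * cis (- (\<theta> / 2))" by (simp add: cis_mult)
  have minus: "cis \<theta> - 1 = 2 * \<i> * of_real (sin (\<theta> / 2)) * cis (\<theta> / 2)"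
    by (subst sq, subst one) (simp add: complex_eq_iff algebra_simps)
  have plus: "cis \<theta> + 1 = 2 * of_real (cos (\<theta> / 2)) * cis (\<theta> / 2)"
    by (subst sq, subst one) (simp add: complex_eq_iff algebra_simps)
  have "sin (\<theta> / 2) \<noteq> 0" using assms minus by auto
  then show ?thesis unfolding minus plus cot_def by simp
qed

text \<open>The factor \<open>\<i>\<close> is left out, so that the value is real.\<close>

definition deriv_symbol :: "grid \<Rightarrow> axis \<Rightarrow> nat \<Rightarrow> real" where
  "deriv_symbol G w j = nu G w * of_int (wave_number (num_pts G w) j)"

text \<open>An entry of the product is a sum of powers of \<open>?z\<close> weighted by wave
  numbers. Off the diagonal its closed form becomes the cotangent by the half-angle identity;
  \<open>h / n\<close> is the factor 1/2 and \<open>?z ^ h\<close> the alternating sign.\<close>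

lemma spectral_diff_diagonalization:
  assumes "box_left G w < box_right G w" "num_pts G w > 0" "even (num_pts G w)"
  shows "spectral_diff G w = idft (num_pts G w) *
    mat_diag (num_pts G w) (\<lambda>j. \<i> * of_real (deriv_symbol G w j)) * dft (num_pts G w)"
proof (rule eq_matI)
  define n where "n = num_pts G w"
  obtain h where h: "n = 2 * h" "h > 0" using assms by (auto simp: n_def elim: evenE)
  have n: "n > 0" using h by simp
  let ?M = "idft n * mat_diag n (\<lambda>j. \<i> * of_real (deriv_symbol G w j)) * dft n"
  fix i j assume "i < dim_row ?M" "j < dim_col ?M"
  then have ij: "i < n" "j < n" by simp_all
  define m where "m = int i - int j"
  let ?z = "unit_root n powi m"
  have carr: "idft n \<in> carrier_mat n n" by (auto intro!: carrier_matI)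
  have "?M $$ (i, j) = (\<Sum>k<n. \<i> * nu G w / of_nat n * (of_int (wave_number n k) * ?z ^ k))"
    unfolding mat_diag_mult_right[OF carr]
    using ij n by (simp add: scalar_prod_def dft_def idft_def lessThan_atLeast0 deriv_symbol_def
        m_def power_int_diff power_divide power_int_minus power_int_of_nat n_def[symmetric]
        field_simps flip: power_mult of_nat_mult)
  also have "\<dots> = \<i> * nu G w / of_nat n * (\<Sum>k<n. of_int (wave_number n k) * ?z ^ k)"
    by (simp add: sum_distrib_left)
  finally have M: "?M $$ (i, j) = \<dots>" .
  show "spectral_diff G w $$ (i, j) = ?M $$ (i, j)"
  proof (cases "i = j")
    case True
    have "(\<Sum>k<n. complex_of_int (wave_number n k)) = 0"
      using sum_wave_number[of n] h by (simp flip: of_int_sum)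
    with True ij show ?thesis unfolding M by (simp add: m_def spectral_diff_def n_def)
  next
    case False
    have "?z \<noteq> 1"
      using False n ij by (simp add: unit_root_powi_eq_1_iff m_def int_dvd_diff_iff)
    moreover have "?z ^ n = 1"
      using unit_root_powi_eq_1_iff[of n "m * int n"] n by (simp add: power_int_mult)
    ultimately have S: "(?z - 1) * (\<Sum>k<n. of_int (wave_number n k) * ?z ^ k)
        = of_nat h * ?z ^ h * (?z + 1)"
      using h by (intro sum_wave_number_times_power)
    \<comment> \<open>Since \<open>h\<close> is half of \<open>n\<close>, this power is half a turn;
      \<open>i - j\<close> and \<open>i + j\<close> have the same parity.\<close>
    have "unit_root n ^ h = -1"
      using h by (simp add: unit_root_eq_cis Complex.DeMoivre)
    then have zh: "?z ^ h = (-1) ^ (i + j)"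
      by (simp add: m_def power_int_diff power_divide power_add power_mult[symmetric]
          mult.commute[of _ h]) (simp add: power_mult minus_one_power_iff)
    define \<theta> where "\<theta> = 2 * pi * of_int m / of_nat n"
    have cis: "?z = cis \<theta>" by (simp add: unit_root_powi \<theta>_def)
    \<comment> \<open>\<open>nu\<close> cancels the box length, since adjacent nodes are one
      \<open>n\<close>-th of it apart.\<close>
    have angle: "nu G w * (node G w i - node G w j) / 2 = \<theta> / 2"
      using assms(1) n by (simp add: nu_def node_def mesh_size_def \<theta>_def m_def n_def[symmetric]
          divide_simps) (simp add: algebra_simps)
    have C: "(?z - 1) * of_real (cot (\<theta> / 2)) = \<i> * (?z + 1)"
      using cot_half_cis[of \<theta>] \<open>?z \<noteq> 1\<close> by (simp add: cis)
    have "(?z - 1) * (\<i> * (\<Sum>k<n. of_int (wave_number n k) * ?z ^ k))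
        = of_nat h * ?z ^ h * (\<i> * (?z + 1))"
      using arg_cong[OF S, of "\<lambda>x. \<i> * x"] by (simp only: mult_ac)
    also have "\<dots> = (?z - 1) * (of_nat h * ?z ^ h * of_real (cot (\<theta> / 2)))"
      using arg_cong[OF C, of "\<lambda>x. of_nat h * ?z ^ h * x"] by (simp only: mult_ac)
    finally have "(?z - 1) * (\<i> * (\<Sum>k<n. of_int (wave_number n k) * ?z ^ k))
        = (?z - 1) * (of_nat h * ?z ^ h * of_real (cot (\<theta> / 2)))" .
    then have "\<i> * (\<Sum>k<n. of_int (wave_number n k) * ?z ^ k)
        = of_nat h * ?z ^ h * of_real (cot (\<theta> / 2))"
      using \<open>?z \<noteq> 1\<close> by simp
    then have "?M $$ (i, j) = nu G w / of_nat n * (of_nat h * ?z ^ h * of_real (cot (\<theta> / 2)))"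
      unfolding M by (simp add: mult_ac)
    also have "\<dots> = spectral_diff G w $$ (i, j)"
      unfolding zh using False ij h by (simp add: spectral_diff_def angle n_def[symmetric])
    finally show ?thesis by simp
  qed
qed (simp_all add: spectral_diff_def)

section \<open>The three-dimensional transform\<close>

fun coord :: "grid \<Rightarrow> axis \<Rightarrow> nat \<Rightarrow> nat" where
  "coord G X_axis p = p mod num_pts G X_axis"
| "coord G Y_axis p = (p div num_pts G X_axis) mod num_pts G Y_axis"
| "coord G Z_axis p = p div (num_pts G X_axis * num_pts G Y_axis)"

text \<open>Kronecker products associate to the right, so the middle coordinate arises as the
  quotient of a remainder, while \<open>coord\<close> takes the remainder of a quotient.\<close>

lemma mod_mult_div: "(p mod (n * m)) div n = (p div n) mod (m :: nat)"
  by (cases "n = 0") (simp_all add: mod_mult2_eq)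

lemma along_axis_mat_diag:
  "along_axis G w (mat_diag (num_pts G w) f) = mat_diag (total_pts G) (\<lambda>p. f (coord G w p))"
  by (cases w) (simp_all add: kron_mat_diag total_pts_def mult_ac mod_mult_div mod_mod_cancel
      flip: mat_diag_one)

lemma dft3_carrier [simp]: "dft3 G \<in> carrier_mat (total_pts G) (total_pts G)"
  and idft3_carrier [simp]: "idft3 G \<in> carrier_mat (total_pts G) (total_pts G)"
  by (auto intro!: carrier_matI simp: dft3_def idft3_def total_pts_def)

lemma coord_less:
  assumes "p < total_pts G"
  shows "coord G w p < num_pts G w"
proof -
  have "num_pts G X_axis > 0" "num_pts G Y_axis > 0"
    using assms by (auto simp: total_pts_def intro!: gr0I)
  with assms show ?thesis
    by (cases w) (auto simp: total_pts_def mult_ac intro!: less_mult_imp_div_less)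
qed

lemma kron3_index:
  assumes "p < total_pts G" "q < total_pts G"
    and "A \<in> carrier_mat (num_pts G Z_axis) (num_pts G Z_axis)"
    and "B \<in> carrier_mat (num_pts G Y_axis) (num_pts G Y_axis)"
    and "C \<in> carrier_mat (num_pts G X_axis) (num_pts G X_axis)"
  shows "(A \<otimes>\<^sub>K B \<otimes>\<^sub>K C) $$ (p, q) = A $$ (coord G Z_axis p, coord G Z_axis q) *
    (B $$ (coord G Y_axis p, coord G Y_axis q) * C $$ (coord G X_axis p, coord G X_axis q))"
proof -
  have "num_pts G X_axis > 0" "num_pts G Y_axis > 0"
    using assms(1) by (auto simp: total_pts_def intro!: gr0I)
  then show ?thesis
    using assms by (auto simp: index_kron total_pts_def mult_ac mod_mult_div mod_mod_cancel)
qed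

lemma idft3_mult_dft3: "(\<And>w. num_pts G w > 0) \<Longrightarrow> idft3 G * dft3 G = 1\<^sub>m (total_pts G)"
  and dft3_mult_idft3: "(\<And>w. num_pts G w > 0) \<Longrightarrow> dft3 G * idft3 G = 1\<^sub>m (total_pts G)"
  by (simp_all add: dft3_def idft3_def kron_mult idft_mult_dft dft_mult_idft kron_one
      total_pts_def mult_ac)

text \<open>By the mixed-product rule the transforms along the other two axes meet as
  \<open>idft n * dft n\<close> and cancel.\<close>

lemma along_axis_conjugate:
  assumes "\<And>w. num_pts G w > 0" and "F \<in> carrier_mat (num_pts G w) (num_pts G w)"
  shows "along_axis G w (idft (num_pts G w) * F * dft (num_pts G w))
    = idft3 G * along_axis G w F * dft3 G"
proof -
  have "idft n * 1\<^sub>m n = idft n" for n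
    by (rule right_mult_one_mat') simp
  then show ?thesis using assms
    by (cases w) (simp_all add: dft3_def idft3_def kron_mult idft_mult_dft)
qed

definition symbol :: "grid \<Rightarrow> axis \<Rightarrow> nat \<Rightarrow> real" where
  "symbol G w p = deriv_symbol G w (coord G w p)"

lemma freq_eq_mat_diag: "freq G w = mat_diag (total_pts G) (\<lambda>p. of_real (symbol G w p))"
  unfolding freq_def freq_diag_def along_axis_mat_diag by (simp add: symbol_def deriv_symbol_def)

lemma diff_op_diagonalization:
  assumes "\<And>w. box_left G w < box_right G w" "\<And>w. num_pts G w > 0" "\<And>w. even (num_pts G w)"
  shows "diff_op G w =
    idft3 G * mat_diag (total_pts G) (\<lambda>p. \<i> * of_real (symbol G w p)) * dft3 G"
  unfolding diff_op_def spectral_diff_diagonalization[OF assms]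
  by (subst along_axis_conjugate) (simp_all add: assms along_axis_mat_diag symbol_def)

text \<open>The flat index of the mode whose wave numbers are the negatives of those of mode \<open>p\<close>.\<close>

definition reflect_index :: "grid \<Rightarrow> nat \<Rightarrow> nat" where
  "reflect_index G p = (neg_mod (num_pts G Z_axis) (coord G Z_axis p) * num_pts G Y_axis
      + neg_mod (num_pts G Y_axis) (coord G Y_axis p)) * num_pts G X_axis
    + neg_mod (num_pts G X_axis) (coord G X_axis p)"

lemma coord_reflect:
  assumes "\<And>w. num_pts G w > 0"
  shows "coord G w (reflect_index G p) = neg_mod (num_pts G w) (coord G w p)"
  using assms by (cases w) (simp_all add: reflect_index_def neg_mod_less div_mult2_eq)

lemma coord_inject:
  assumes "\<And>w. coord G w p = coord G w q"
  shows "p = q"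
proof -
  have "p div num_pts G X_axis = q div num_pts G X_axis"
    using assms[of Y_axis] assms[of Z_axis] by (simp add: div_mult2_eq) (metis div_mult_mod_eq)
  with assms[of X_axis] show ?thesis by (simp) (metis div_mult_mod_eq)
qed

lemma reflect_index_less:
  assumes "\<And>w. num_pts G w > 0" "p < total_pts G"
  shows "reflect_index G p < total_pts G"
proof -
  have "reflect_index G p div (num_pts G X_axis * num_pts G Y_axis) < num_pts G Z_axis"
    using coord_reflect[OF assms(1), of Z_axis p] neg_mod_less[OF assms(1)] by simp
  then show ?thesis
    using assms(1) by (simp add: total_pts_def div_less_iff_less_mult mult_ac)
qed

lemma reflect_index_involution:
  assumes "\<And>w. num_pts G w > 0" "p < total_pts G"
  shows "reflect_index G (reflect_index G p) = p"
  by (rule coord_inject[of G]) (simp add: coord_reflect assms neg_mod_neg_mod coord_less)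

lemma symbol_reflect:
  assumes "\<And>w. num_pts G w > 0" "\<And>w. even (num_pts G w)" "p < total_pts G"
  shows "symbol G w (reflect_index G p) = - symbol G w p"
  by (simp add: symbol_def deriv_symbol_def coord_reflect wave_number_neg_mod coord_less assms)

section \<open>Conjugation symmetry of the transform and Parseval's identity\<close>

lemma cnj_unit_root_powi: "cnj (unit_root n powi m) = unit_root n powi (- m)"
  by (simp add: unit_root_powi cis_cnj)

lemma unit_root_powi_cong:
  assumes "n > 0" "int n dvd a - b"
  shows "unit_root n powi a = unit_root n powi b"
proof -
  have "unit_root n powi (a - b) = 1" using assms by (simp add: unit_root_powi_eq_1_iff)
  then show ?thesis by (simp add: power_int_diff)
qed

text \<open>Negating the row index modulo \<open>n\<close> negates the exponent modulo
  \<open>n\<close>, and conjugation inverts the root of unity.\<close>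

lemma dft_neg_mod:
  assumes "n > 0" "j < n" "k < n"
  shows "dft n $$ (neg_mod n j, k) = cnj (dft n $$ (j, k))"
proof -
  have "int n dvd int (neg_mod n j) + int j"
    using assms by (cases "j = 0") (simp_all add: neg_mod_def)
  then have "int n dvd (int (neg_mod n j) + int j) * int k" by (rule dvd_mult2)
  then have "int n dvd - int (neg_mod n j * k) - int (j * k)"
    by (simp add: algebra_simps flip: dvd_minus_iff[of _ "- _ - _"])
  then have "unit_root n powi - int (neg_mod n j * k) = unit_root n powi int (j * k)"
    by (rule unit_root_powi_cong[OF assms(1)])
  with assms show ?thesis
    by (simp add: dft_def cnj_unit_root_powi neg_mod_less del: of_nat_mult complex_cnj_power_int)
qed

text \<open>The DFT matrix is unitary up to scaling, so the adjoint of its inverse is a multiple of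
  the matrix itself.\<close>

lemma cnj_idft:
  assumes "j < n" "k < n"
  shows "cnj (idft n $$ (j, k)) = 1 / of_nat n * dft n $$ (k, j)"
  using assms by (simp add: idft_def dft_def cnj_unit_root power_int_minus mult.commute[of j]
      power_int_of_nat power_inverse flip: of_nat_mult)

lemma dft3_reflect:
  assumes "\<And>w. num_pts G w > 0" "p < total_pts G" "q < total_pts G"
  shows "dft3 G $$ (reflect_index G p, q) = cnj (dft3 G $$ (p, q))"
  unfolding dft3_def using assms reflect_index_less[OF assms(1,2)]
  by (simp add: kron3_index coord_reflect dft_neg_mod coord_less del: coord.simps)

lemma cnj_idft3:
  assumes "p < total_pts G" "q < total_pts G"
  shows "cnj (idft3 G $$ (p, q)) = 1 / of_nat (total_pts G) * dft3 G $$ (q, p)"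
  unfolding dft3_def idft3_def using assms
  by (simp add: kron3_index cnj_idft coord_less total_pts_def del: coord.simps)

text \<open>Moved to the left argument, the second transform becomes its adjoint, a multiple of
  \<open>dft3 G\<close>, which cancels the first transform.\<close>

lemma idft3_parseval:
  assumes pos: "\<And>w. num_pts G w > 0"
    and "u \<in> carrier_vec (total_pts G)" "v \<in> carrier_vec (total_pts G)"
  shows "(idft3 G *\<^sub>v u) \<bullet>c (idft3 G *\<^sub>v v) = 1 / of_nat (total_pts G) * (u \<bullet>c v)"
proof -
  let ?n = "total_pts G"
  have "(idft3 G *\<^sub>v u) \<bullet>c (idft3 G *\<^sub>v v)
      = (\<Sum>i<?n. (idft3 G *\<^sub>v u) $ i * (\<Sum>p<?n. cnj (idft3 G $$ (i, p)) * cnj (v $ p)))"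
    using assms carrier_matD[OF idft3_carrier[of G]]
    by (simp add: scalar_prod_def lessThan_atLeast0)
  also have "\<dots> = (\<Sum>i<?n. \<Sum>p<?n.
      1 / of_nat ?n * (dft3 G $$ (p, i) * (idft3 G *\<^sub>v u) $ i * cnj (v $ p)))"
    by (simp add: cnj_idft3 sum_distrib_left mult_ac)
  also have "\<dots> = 1 / of_nat ?n *
      (\<Sum>p<?n. (\<Sum>i<?n. dft3 G $$ (p, i) * (idft3 G *\<^sub>v u) $ i) * cnj (v $ p))"
    by (subst sum.swap) (simp add: sum_distrib_left sum_distrib_right)
  also have "(\<Sum>p<?n. (\<Sum>i<?n. dft3 G $$ (p, i) * (idft3 G *\<^sub>v u) $ i) * cnj (v $ p))
      = (dft3 G *\<^sub>v (idft3 G *\<^sub>v u)) \<bullet>c v"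
    using assms carrier_matD[OF idft3_carrier[of G]] carrier_matD[OF dft3_carrier[of G]]
    by (simp add: scalar_prod_def lessThan_atLeast0)
  also have "dft3 G *\<^sub>v (idft3 G *\<^sub>v u) = u"
    using assms by (simp add: dft3_mult_idft3 flip: assoc_mult_mat_vec[of _ ?n ?n _ ?n])
  finally show ?thesis .
qed

section \<open>Hermitian symmetric spectra and the discrete momentum\<close>

text \<open>The terms are written out so that vector identities unfold to polynomial
  identities.\<close>

definition axis_sum :: "(axis \<Rightarrow> complex) \<Rightarrow> complex" where
  "axis_sum f = f X_axis + f Y_axis + f Z_axis"

text \<open>The Hermitian product on C^3, conjugate linear in \<open>e\<close>.\<close>

definition flux :: "(axis \<Rightarrow> complex) \<Rightarrow> (axis \<Rightarrow> complex) \<Rightarrow> complex" where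
  "flux h e = axis_sum (\<lambda>w. h w * cnj (e w))"

text \<open>The mark of the spectrum of a real field, put as a condition on the spectrum alone so
  that it can be checked after propagation.\<close>

definition hermitian_sym :: "grid \<Rightarrow> vfield \<Rightarrow> bool" where
  "hermitian_sym G u \<longleftrightarrow> (\<forall>w. u w \<in> carrier_vec (total_pts G) \<and>
    (\<forall>p < total_pts G. u w $ reflect_index G p = cnj (u w $ p)))"

lemma hermitian_sym_dft3:
  assumes "\<And>w. num_pts G w > 0" "\<And>w. u w \<in> carrier_vec (total_pts G)"
    and "\<And>w i. i < total_pts G \<Longrightarrow> cnj (u w $ i) = u w $ i"
  shows "hermitian_sym G (\<lambda>w. dft3 G *\<^sub>v u w)"
  unfolding hermitian_sym_def
proof (intro allI conjI impI)
  fix w p assume p: "p < total_pts G"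
  note p' = reflect_index_less[OF assms(1) p]
  from p p' show "(dft3 G *\<^sub>v u w) $ reflect_index G p = cnj ((dft3 G *\<^sub>v u w) $ p)"
    using assms carrier_matD[OF dft3_carrier[of G]]
    by (simp add: carrier_vecD[OF assms(2)] scalar_prod_def dft3_reflect)
qed (use assms in \<open>auto intro: mult_mat_vec_carrier[OF dft3_carrier]\<close>)

definition mode_flux :: "vfield \<Rightarrow> vfield \<Rightarrow> nat \<Rightarrow> complex" where
  "mode_flux u v p = flux (\<lambda>w. u w $ p) (\<lambda>w. v w $ p)"

lemma sum_odd_eq_zero:
  fixes f :: "nat \<Rightarrow> real"
  assumes "\<And>w. num_pts G w > 0"
    and "\<And>p. p < total_pts G \<Longrightarrow> f (reflect_index G p) = - f p"
  shows "(\<Sum>p<total_pts G. f p) = 0"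
proof -
  have "(\<Sum>p<total_pts G. f p) = (\<Sum>p<total_pts G. - f p)"
    by (rule sum.reindex_bij_witness[of _ "reflect_index G" "reflect_index G"])
      (simp_all add: assms reflect_index_less[OF assms(1)] reflect_index_involution[OF assms(1)])
  then show ?thesis by (simp add: sum_negf)
qed

lemma block_diag_mult_vec:
  assumes "M \<in> carrier_mat (total_pts G) (total_pts G)" "\<And>v. u v \<in> carrier_vec (total_pts G)"
  shows "(block_diag G M *\<^sub>b u) w = M *\<^sub>v u w"
proof -
  have "M *\<^sub>v u w \<in> carrier_vec (total_pts G)" for w
    using assms by (rule mult_mat_vec_carrier)
  moreover have "0\<^sub>m (total_pts G) (total_pts G) *\<^sub>v u w = 0\<^sub>v (total_pts G)" for w
    by (rule eq_vecI) (use assms(2)[of w] in simp_all)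
  ultimately show ?thesis
    using assms by (cases w) (simp_all add: block_mult_vec_def block_diag_def)
qed

text \<open>One factor \<open>1 / total_pts G\<close> comes from \<open>inner_N\<close>, the other
  from Parseval's identity.\<close>

lemma inner_N_diff_op:
  assumes G: "\<And>w. box_left G w < box_right G w" "\<And>w. num_pts G w > 0" "\<And>w. even (num_pts G w)"
    and u: "hermitian_sym G u" and v: "hermitian_sym G v"
  shows "inner_N G (\<lambda>w. idft3 G *\<^sub>v u w)
      (block_diag G (diff_op G k) *\<^sub>b (\<lambda>w. idft3 G *\<^sub>v v w))
    = of_real ((\<Sum>p<total_pts G. symbol G k p * Im (mode_flux u v p)) / (real (total_pts G))\<^sup>2)"
proof -
  let ?n = "total_pts G"
  let ?L = "mat_diag ?n (\<lambda>p. \<i> * complex_of_real (symbol G k p))"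
  have carr: "u w \<in> carrier_vec ?n" "v w \<in> carrier_vec ?n" for w
    using u v by (auto simp: hermitian_sym_def)
  have D: "diff_op G k \<in> carrier_mat ?n ?n"
    unfolding diff_op_diagonalization[OF G]
    by (rule mult_carrier_mat[OF mult_carrier_mat[OF idft3_carrier mat_diag_dim] dft3_carrier])
  have "diff_op G k *\<^sub>v (idft3 G *\<^sub>v v w) = idft3 G *\<^sub>v (?L *\<^sub>v v w)" for w
  proof -
    have "diff_op G k *\<^sub>v (idft3 G *\<^sub>v v w) = (diff_op G k * idft3 G) *\<^sub>v v w"
      by (rule assoc_mult_mat_vec[symmetric, OF D _ carr(2)]) simp
    also have "diff_op G k * idft3 G = idft3 G * ?L * (dft3 G * idft3 G)"
      unfolding diff_op_diagonalization[OF G]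
      by (rule assoc_mult_mat[OF mult_carrier_mat[OF idft3_carrier mat_diag_dim]
            dft3_carrier idft3_carrier])
    also have "\<dots> = idft3 G * ?L"
      unfolding dft3_mult_idft3[OF G(2)]
      by (rule right_mult_one_mat[OF mult_carrier_mat[OF idft3_carrier mat_diag_dim]])
    also have "(idft3 G * ?L) *\<^sub>v v w = idft3 G *\<^sub>v (?L *\<^sub>v v w)"
      by (rule assoc_mult_mat_vec[OF idft3_carrier mat_diag_dim carr(2)])
    finally show ?thesis .
  qed
  then have "(block_diag G (diff_op G k) *\<^sub>b (\<lambda>w. idft3 G *\<^sub>v v w)) w = idft3 G *\<^sub>v (?L *\<^sub>v v w)"
    for w
    by (subst block_diag_mult_vec[OF D]) (auto intro: mult_mat_vec_carrier[OF idft3_carrier carr(2)])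
  then have "inner_N G (\<lambda>w. idft3 G *\<^sub>v u w)
      (block_diag G (diff_op G k) *\<^sub>b (\<lambda>w. idft3 G *\<^sub>v v w))
    = 1 / of_nat ?n * (\<Sum>w\<in>{X_axis, Y_axis, Z_axis}. 1 / of_nat ?n * (u w \<bullet>c (?L *\<^sub>v v w)))"
    unfolding inner_N_def
    by (simp only: idft3_parseval[OF G(2) carr(1) mult_mat_vec_carrier[OF mat_diag_dim carr(2)]])
  also have "\<dots> = 1 / (of_nat ?n)\<^sup>2 * (\<Sum>p<?n. - \<i> * of_real (symbol G k p) * mode_flux u v p)"
  proof -
    have "u w \<bullet>c (?L *\<^sub>v v w)
        = (\<Sum>p<?n. - \<i> * of_real (symbol G k p) * (u w $ p * cnj (v w $ p)))" for w
      using carr by (simp add: mat_diag_mult_vec scalar_prod_def lessThan_atLeast0 mult_ac)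
    then show ?thesis
      by (simp only: mode_flux_def flux_def axis_sum_def distrib_left sum.distrib)
        (simp add: power2_eq_square algebra_simps)
  qed
  \<comment> \<open>The sign of \<open>\<i>\<close> comes from conjugating the second argument.
    Multiplication by \<open>- \<i>\<close> makes \<open>Im\<close> the real part, and the sum with
    \<open>Re\<close> then cancels under reflection.\<close>
  also have "(\<Sum>p<?n. - \<i> * of_real (symbol G k p) * mode_flux u v p)
      = of_real (\<Sum>p<?n. symbol G k p * Im (mode_flux u v p))
        - \<i> * of_real (\<Sum>p<?n. symbol G k p * Re (mode_flux u v p))"
    by (simp add: complex_eq_iff flip: sum_negf)
  also have "(\<Sum>p<?n. symbol G k p * Re (mode_flux u v p)) = 0"
  proof (rule sum_odd_eq_zero[OF G(2)])
    fix p assume "p < ?n"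
    then have "mode_flux u v (reflect_index G p) = cnj (mode_flux u v p)"
      using u v by (simp add: hermitian_sym_def mode_flux_def flux_def axis_sum_def)
    then show "symbol G k (reflect_index G p) * Re (mode_flux u v (reflect_index G p))
        = - (symbol G k p * Re (mode_flux u v p))"
      using symbol_reflect[OF G(2,3) \<open>p < ?n\<close>] by simp
  qed
  finally show ?thesis by simp
qed

section \<open>The propagator at a single mode\<close>

fun cross :: "(axis \<Rightarrow> complex) \<Rightarrow> (axis \<Rightarrow> complex) \<Rightarrow> axis \<Rightarrow> complex" where
  "cross k h X_axis = k Y_axis * h Z_axis - k Z_axis * h Y_axis"
| "cross k h Y_axis = k Z_axis * h X_axis - k X_axis * h Z_axis"
| "cross k h Z_axis = k X_axis * h Y_axis - k Y_axis * h X_axis"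

text \<open>For real \<open>k\<close>, let S be the Hermitian matrix of
  \<open>h \<mapsto> \<i> * cross k h\<close>. The bracket is S^2 applied to \<open>h\<close>, and
  with the coefficients \<open>A_coeff\<close> and \<open>B_coeff\<close> at |k|^2,
  \<open>cos_op\<close> and \<open>sin_op\<close> are the cosine and sine of S.\<close>

definition cos_op :: "complex \<Rightarrow> (axis \<Rightarrow> complex) \<Rightarrow> (axis \<Rightarrow> complex) \<Rightarrow> axis \<Rightarrow> complex" where
  "cos_op a k h w = h w + a * (axis_sum (\<lambda>v. k v * k v) * h w - k w * axis_sum (\<lambda>v. k v * h v))"

definition sin_op :: "complex \<Rightarrow> (axis \<Rightarrow> complex) \<Rightarrow> (axis \<Rightarrow> complex) \<Rightarrow> axis \<Rightarrow> complex" where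
  "sin_op b k h w = \<i> * b * cross k h w"

text \<open>With S Hermitian and S^3 = |k|^2 S, both products reduce to \<open>flux h e\<close> and
  multiples of \<open>?X\<close>, the product of S h and S e. The relation between \<open>a\<close>
  and \<open>b\<close> makes the coefficient of \<open>?X\<close> vanish.\<close>

lemma flux_cos_sin:
  assumes "\<And>w. cnj (k w) = k w" "cnj a = a" "cnj b = b"
    and "b * b = - 2 * a - axis_sum (\<lambda>v. k v * k v) * (a * a)"
  shows "flux (cos_op a k h) (cos_op a k e) + flux (sin_op b k h) (sin_op b k e) = flux h e"
proof -
  let ?K = "axis_sum (\<lambda>v. k v * k v)" and ?X = "flux (cross k h) (cross k e)"
  have "flux (sin_op b k h) (sin_op b k e) = b * b * ?X"
    by (simp add: flux_def sin_op_def axis_sum_def assms(1-3) algebra_simps)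
  moreover have "flux (cos_op a k h) (cos_op a k e) = flux h e + 2 * a * ?X + ?K * (a * a) * ?X"
    by (simp add: flux_def cos_op_def axis_sum_def assms(1-3) algebra_simps)
  ultimately show ?thesis
    by (simp only: assms(4)) (simp add: algebra_simps)
qed

text \<open>Both operators are real polynomials in the same Hermitian matrix, so their product is
  Hermitian and its quadratic form real.\<close>

lemma Im_flux_cos_sin:
  assumes "\<And>w. cnj (k w) = k w" "cnj a = a" "cnj b = b"
  shows "Im (flux (cos_op a k h) (sin_op b k h)) = 0"
proof -
  have "cnj (flux (cos_op a k h) (sin_op b k h)) = flux (cos_op a k h) (sin_op b k h)"
    by (simp add: flux_def cos_op_def sin_op_def axis_sum_def assms(1-3) algebra_simps)
  then show ?thesis by (simp add: complex_eq_iff)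
qed

lemma cnj_flux: "cnj (flux h e) = flux e h"
  by (simp add: flux_def axis_sum_def mult.commute)

lemma Im_flux_swap: "Im (flux e h) = - Im (flux h e)"
  by (simp flip: cnj_flux[of h e])

text \<open>Of the four terms of the expansion the two mixed ones have real flux. The sine term has
  weight \<open>- (q * r) = -1\<close> and its arguments swapped; swapping them back flips the sign
  of \<open>Im\<close>, which leaves the sum in \<open>flux_cos_sin\<close>.\<close>

lemma Im_flux_propagator:
  fixes q r :: real
  assumes "\<And>w. cnj (k w) = k w" "cnj a = a" "cnj b = b"
    and "b * b = - 2 * a - axis_sum (\<lambda>v. k v * k v) * (a * a)"
    and "q * r = 1"
  shows "Im (flux (\<lambda>w. cos_op a k h w - of_real q * sin_op b k e w)
      (\<lambda>w. cos_op a k e w + of_real r * sin_op b k h w)) = Im (flux h e)"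
proof -
  have "flux (\<lambda>w. cos_op a k h w - of_real q * sin_op b k e w)
      (\<lambda>w. cos_op a k e w + of_real r * sin_op b k h w)
    = flux (cos_op a k h) (cos_op a k e) + of_real r * flux (cos_op a k h) (sin_op b k h)
      - of_real q * flux (sin_op b k e) (cos_op a k e) - of_real (q * r) * flux (sin_op b k e) (sin_op b k h)"
    by (simp add: flux_def axis_sum_def algebra_simps)
  then have "Im (flux (\<lambda>w. cos_op a k h w - of_real q * sin_op b k e w)
      (\<lambda>w. cos_op a k e w + of_real r * sin_op b k h w))
    = Im (flux (cos_op a k h) (cos_op a k e)) + Im (flux (sin_op b k h) (sin_op b k e))"
    using Im_flux_cos_sin[OF assms(1-3), where h = h] Im_flux_cos_sin[OF assms(1-3), where h = e]
    by (simp add: assms(5) Im_flux_swap[of "sin_op b k e"])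
  also have "\<dots> = Im (flux h e)"
    using arg_cong[OF flux_cos_sin[OF assms(1-4), where h = h and e = e], of Im] by simp
  finally show ?thesis .
qed

section \<open>The propagator blocks as functions of the wave vector\<close>

definition wave_vec :: "grid \<Rightarrow> real \<Rightarrow> nat \<Rightarrow> axis \<Rightarrow> complex" where
  "wave_vec G \<tau> p w = of_real (\<tau> * symbol G w p)"

definition A_coeff :: "real \<Rightarrow> real" where
  "A_coeff r = (if r = 0 then - 1 / 2 else (cos (sqrt r) - 1) / r)"

definition B_coeff :: "real \<Rightarrow> real" where
  "B_coeff r = (if r = 0 then 1 else sin (sqrt r) / sqrt r)"

text \<open>With \<open>a = (cos - 1) / r\<close> and \<open>b = sin / sqrt r\<close> this is \<open>cos\<^sup>2 + sin\<^sup>2 = 1\<close> divided by \<open>r\<close>,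
  a form that stays valid for \<open>r = 0\<close>.\<close>

lemma B_coeff_squared:
  assumes "r \<ge> 0"
  shows "B_coeff r * B_coeff r = - 2 * A_coeff r - r * (A_coeff r * A_coeff r)"
proof (cases "r = 0")
  case False
  have "r * (cos (sqrt r) * cos (sqrt r)) + r * (sin (sqrt r) * sin (sqrt r)) = r"
    by (simp flip: distrib_left power2_eq_square)
  with False assms show ?thesis
    by (simp add: A_coeff_def B_coeff_def field_simps)
qed (simp add: A_coeff_def B_coeff_def)

definition wave_norm2 :: "grid \<Rightarrow> real \<Rightarrow> nat \<Rightarrow> real" where
  "wave_norm2 G \<tau> p = (\<tau> * symbol G X_axis p)\<^sup>2 + (\<tau> * symbol G Y_axis p)\<^sup>2
    + (\<tau> * symbol G Z_axis p)\<^sup>2"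

lemma Psi_eq_mat_diag: "Psi G \<tau> = mat_diag (total_pts G) (\<lambda>p. of_real (wave_norm2 G \<tau> p))"
  by (simp add: Psi_def freq_eq_mat_diag mat_diag_simps wave_norm2_def power2_eq_square algebra_simps
      del: mat_diag_one)

text \<open>The principal root of a nonpositive real number has real part 0 and nonnegative
  imaginary part.\<close>

lemma csqrt_minus_of_real: "r \<ge> 0 \<Longrightarrow> csqrt (- of_real r) = \<i> * of_real (sqrt r)"
  by (rule csqrt_unique) (auto simp: power_mult_distrib simp flip: of_real_power)

lemma cosh_i_times: "cosh (\<i> * of_real x) = of_real (cos x)"
  and sinh_i_times: "sinh (\<i> * of_real x) = \<i> * of_real (sin x)"
  by (simp_all add: cosh_def sinh_def complex_eq_iff Re_exp Im_exp)

lemma A_mat_eq_mat_diag: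
  "A_mat G \<tau> = mat_diag (total_pts G) (\<lambda>p. of_real (A_coeff (wave_norm2 G \<tau> p)))"
proof -
  have "wave_norm2 G \<tau> p \<ge> 0" for p by (simp add: wave_norm2_def)
  then show ?thesis
    by (auto simp: A_mat_def Psi_eq_mat_diag A_coeff_def csqrt_minus_of_real cosh_i_times
        Let_def mat_diag_def intro!: eq_matI)
qed

lemma B_mat_eq_mat_diag:
  "B_mat G \<tau> = mat_diag (total_pts G) (\<lambda>p. of_real (B_coeff (wave_norm2 G \<tau> p)))"
proof -
  have "wave_norm2 G \<tau> p \<ge> 0" for p by (simp add: wave_norm2_def)
  then show ?thesis
    by (auto simp: B_mat_def Psi_eq_mat_diag B_coeff_def csqrt_minus_of_real sinh_i_times
        Let_def mat_diag_def intro!: eq_matI)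
qed

text \<open>A diagonal block holds the squares of the two other frequencies, which is |k|^2 minus
  its own square, as in \<open>cos_op\<close>.\<close>

lemma c_mat_mult_vec:
  assumes "\<And>v. u v \<in> carrier_vec (total_pts G)"
  shows "(c_mat G \<tau> *\<^sub>b u) w = vec (total_pts G) (\<lambda>p.
    cos_op (of_real (A_coeff (wave_norm2 G \<tau> p))) (wave_vec G \<tau> p) (\<lambda>v. u v $ p) w)"
  by (cases w; rule eq_vecI) (simp_all add: block_mult_vec_def c_diag_def c_off_def freq_eq_mat_diag
      A_mat_eq_mat_diag mat_diag_simps mat_diag_mult_vec assms cos_op_def axis_sum_def wave_vec_def
      power2_eq_square algebra_simps del: mat_diag_one)

lemma s_mat_mult_vec:
  assumes "\<And>v. u v \<in> carrier_vec (total_pts G)"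
  shows "(s_mat G \<tau> *\<^sub>b u) w = vec (total_pts G) (\<lambda>p.
    sin_op (of_real (B_coeff (wave_norm2 G \<tau> p))) (wave_vec G \<tau> p) (\<lambda>v. u v $ p) w)"
  by (cases w; rule eq_vecI) (simp_all add: block_mult_vec_def s_off_def freq_eq_mat_diag
      B_mat_eq_mat_diag mat_diag_simps mat_diag_mult_vec assms sin_op_def wave_vec_def
      algebra_simps del: mat_diag_one)

section \<open>Conservation of momentum\<close>

lemma grid_vec_carrier [simp]: "grid_vec G f \<in> carrier_vec (total_pts G)"
  by (simp add: grid_vec_def)

lemma cnj_grid_vec: "i < total_pts G \<Longrightarrow> cnj (grid_vec G f $ i) = grid_vec G f $ i"
  by (simp add: grid_vec_def Let_def)

text \<open>The wave vector is real; the conjugate is written so that both sides of the symmetry of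
  \<open>propagate\<close> become polynomials in the same conjugated quantities.\<close>

lemma wave_vec_reflect:
  assumes "\<And>w. num_pts G w > 0" "\<And>w. even (num_pts G w)" "p < total_pts G"
  shows "wave_vec G \<tau> (reflect_index G p) w = - cnj (wave_vec G \<tau> p w)"
    and "wave_norm2 G \<tau> (reflect_index G p) = wave_norm2 G \<tau> p"
  by (simp_all add: wave_vec_def wave_norm2_def symbol_reflect assms)

text \<open>With \<open>q = sqrt \<epsilon> / sqrt \<mu>\<close> this is the spectrum of \<open>scheme_H\<close>. The spectrum of \<open>scheme_E\<close>
  has the roles of the fields exchanged and \<open>q = - sqrt \<mu> / sqrt \<epsilon>\<close>.\<close>

definition propagate ::
  "grid \<Rightarrow> real \<Rightarrow> real \<Rightarrow> vfield \<Rightarrow> vfield \<Rightarrow> vfield" where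
  "propagate G \<tau> q e h w = vec (total_pts G) (\<lambda>p.
    cos_op (of_real (A_coeff (wave_norm2 G \<tau> p))) (wave_vec G \<tau> p) (\<lambda>v. h v $ p) w
    - of_real q * sin_op (of_real (B_coeff (wave_norm2 G \<tau> p))) (wave_vec G \<tau> p) (\<lambda>v. e v $ p) w)"

text \<open>Reflection negates the wave vector. \<open>cos_op\<close> is even in it;
  \<open>sin_op\<close> is odd, and conjugating its factor \<open>\<i>\<close> supplies the matching
  sign.\<close>

lemma hermitian_sym_propagate:
  assumes G: "\<And>w. num_pts G w > 0" "\<And>w. even (num_pts G w)"
    and "hermitian_sym G e" "hermitian_sym G h"
  shows "hermitian_sym G (propagate G \<tau> q e h)"
  unfolding hermitian_sym_def
proof (intro allI conjI impI)
  fix w p assume p: "p < total_pts G"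
  have eh: "e v $ reflect_index G p = cnj (e v $ p)" "h v $ reflect_index G p = cnj (h v $ p)" for v
    using assms(3,4) p by (simp_all add: hermitian_sym_def)
  show "propagate G \<tau> q e h w $ reflect_index G p = cnj (propagate G \<tau> q e h w $ p)"
    using p reflect_index_less[OF G(1) p]
    by (cases w) (simp_all add: propagate_def eh wave_vec_reflect[OF G p] cos_op_def sin_op_def
        axis_sum_def algebra_simps)
qed (simp add: propagate_def)

text \<open>\<open>propagate\<close> subtracts its sine term, so the parameter \<open>- r\<close>
  gives the sum in \<open>Im_flux_propagator\<close>.\<close>

lemma Im_mode_flux_spectral:
  assumes "p < total_pts G" "q * r = 1"
  shows "Im (mode_flux (propagate G \<tau> q e h) (propagate G \<tau> (- r) h e) p) = Im (mode_flux h e p)"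
proof -
  let ?a = "complex_of_real (A_coeff (wave_norm2 G \<tau> p))"
    and ?b = "complex_of_real (B_coeff (wave_norm2 G \<tau> p))" and ?k = "wave_vec G \<tau> p"
  have K: "axis_sum (\<lambda>v. ?k v * ?k v) = of_real (wave_norm2 G \<tau> p)"
    by (simp add: axis_sum_def wave_vec_def wave_norm2_def power2_eq_square)
  have "wave_norm2 G \<tau> p \<ge> 0" by (simp add: wave_norm2_def)
  from arg_cong[OF B_coeff_squared[OF this], of complex_of_real]
  have "?b * ?b = - 2 * ?a - axis_sum (\<lambda>v. ?k v * ?k v) * (?a * ?a)"
    unfolding K by simp
  moreover have "cnj (?k w) = ?k w" for w by (simp add: wave_vec_def)
  ultimately have "Im (flux
      (\<lambda>w. cos_op ?a ?k (\<lambda>v. h v $ p) w - of_real q * sin_op ?b ?k (\<lambda>v. e v $ p) w)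
      (\<lambda>w. cos_op ?a ?k (\<lambda>v. e v $ p) w + of_real r * sin_op ?b ?k (\<lambda>v. h v $ p) w))
    = Im (flux (\<lambda>v. h v $ p) (\<lambda>v. e v $ p))"
    by (intro Im_flux_propagator assms(2)) simp_all
  with assms(1) show ?thesis by (simp add: mode_flux_def propagate_def)
qed

lemma scheme_H_eq:
  assumes "\<epsilon> > 0" "\<mu> > 0"
    and "\<And>w. E0 w \<in> carrier_vec (total_pts G)" "\<And>w. H0 w \<in> carrier_vec (total_pts G)"
  shows "scheme_H G \<epsilon> \<mu> E0 H0 t = (\<lambda>w. idft3 G *\<^sub>v
    propagate G (t / sqrt (\<mu> * \<epsilon>)) (sqrt \<epsilon> / sqrt \<mu>)
      (\<lambda>w. dft3 G *\<^sub>v E0 w) (\<lambda>w. dft3 G *\<^sub>v H0 w) w)"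
proof -
  have "dft3 G *\<^sub>v E0 w \<in> carrier_vec (total_pts G)" "dft3 G *\<^sub>v H0 w \<in> carrier_vec (total_pts G)" for w
    using assms by (auto intro: mult_mat_vec_carrier[OF dft3_carrier])
  note S = c_mat_mult_vec[of "\<lambda>w. dft3 G *\<^sub>v H0 w", OF this(2)]
    s_mat_mult_vec[of "\<lambda>w. dft3 G *\<^sub>v E0 w", OF this(1)]
  show ?thesis
    unfolding scheme_H_def Let_def S
    by (rule ext, rule arg_cong[where f = "\<lambda>v. idft3 G *\<^sub>v v"], rule eq_vecI)
      (use assms(1,2) in \<open>simp_all add: propagate_def field_simps\<close>)
qed

lemma scheme_E_eq:
  assumes "\<epsilon> > 0" "\<mu> > 0"
    and "\<And>w. E0 w \<in> carrier_vec (total_pts G)" "\<And>w. H0 w \<in> carrier_vec (total_pts G)"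
  shows "scheme_E G \<epsilon> \<mu> E0 H0 t = (\<lambda>w. idft3 G *\<^sub>v
    propagate G (t / sqrt (\<mu> * \<epsilon>)) (- (sqrt \<mu> / sqrt \<epsilon>))
      (\<lambda>w. dft3 G *\<^sub>v H0 w) (\<lambda>w. dft3 G *\<^sub>v E0 w) w)"
proof -
  have "dft3 G *\<^sub>v E0 w \<in> carrier_vec (total_pts G)" "dft3 G *\<^sub>v H0 w \<in> carrier_vec (total_pts G)" for w
    using assms by (auto intro: mult_mat_vec_carrier[OF dft3_carrier])
  note S = c_mat_mult_vec[of "\<lambda>w. dft3 G *\<^sub>v E0 w", OF this(1)]
    s_mat_mult_vec[of "\<lambda>w. dft3 G *\<^sub>v H0 w", OF this(2)]
  show ?thesis
    unfolding scheme_E_def Let_def S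
    by (rule ext, rule arg_cong[where f = "\<lambda>v. idft3 G *\<^sub>v v"], rule eq_vecI)
      (use assms(1,2) in \<open>simp_all add: propagate_def field_simps\<close>)
qed

theorem theorem4p4:
  fixes G :: grid
    and \<epsilon> \<mu> t_end :: real
    and Einit Hinit :: "axis \<Rightarrow> real \<times> real \<times> real \<Rightarrow> real"
    and E0 H0 :: vfield
    and k :: axis
  assumes "\<epsilon> > 0" and "\<mu> > 0" and "t_end \<ge> 0"
    and "\<And>w. box_left G w < box_right G w"
    and "\<And>w. num_pts G w > 0" and "\<And>w. even (num_pts G w)"
    and "E0 = (\<lambda>w. grid_vec G (Einit w))"
    and "H0 = (\<lambda>w. grid_vec G (Hinit w))"
  shows "momentum1 G k (scheme_E G \<epsilon> \<mu> E0 H0 t_end) (scheme_H G \<epsilon> \<mu> E0 H0 t_end)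
           = momentum1 G k E0 H0
       \<and> momentum2 G k (scheme_E G \<epsilon> \<mu> E0 H0 t_end) (scheme_H G \<epsilon> \<mu> E0 H0 t_end)
           = momentum2 G k E0 H0"
proof -
  let ?\<tau> = "t_end / sqrt (\<mu> * \<epsilon>)" and ?q = "sqrt \<epsilon> / sqrt \<mu>" and ?r = "sqrt \<mu> / sqrt \<epsilon>"
  define Eh where "Eh = (\<lambda>w. dft3 G *\<^sub>v E0 w)"
  define Hh where "Hh = (\<lambda>w. dft3 G *\<^sub>v H0 w)"
  define Et where "Et = propagate G ?\<tau> (- ?r) Hh Eh"
  define Ht where "Ht = propagate G ?\<tau> ?q Eh Hh"
  have carr: "E0 w \<in> carrier_vec (total_pts G)" "H0 w \<in> carrier_vec (total_pts G)" for w
    by (simp_all add: assms(7,8))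
  have sym0: "hermitian_sym G Eh" "hermitian_sym G Hh"
    unfolding Eh_def Hh_def
    by (rule hermitian_sym_dft3[OF assms(5)]; simp add: assms(7,8) cnj_grid_vec)+
  have sym: "hermitian_sym G Et" "hermitian_sym G Ht"
    unfolding Et_def Ht_def by (intro hermitian_sym_propagate assms(5,6) sym0)+
  have inv: "idft3 G *\<^sub>v (dft3 G *\<^sub>v u) = u" if "u \<in> carrier_vec (total_pts G)" for u
    using that idft3_mult_dft3[OF assms(5)]
    by (simp flip: assoc_mult_mat_vec[of _ "total_pts G" "total_pts G" _ "total_pts G"])
  \<comment> \<open>The initial fields take the same form as the final ones, so that one momentum
    formula serves both times.\<close>
  have init: "E0 = (\<lambda>w. idft3 G *\<^sub>v Eh w)" "H0 = (\<lambda>w. idft3 G *\<^sub>v Hh w)"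
    by (simp_all add: Eh_def Hh_def inv carr)
  have final: "scheme_E G \<epsilon> \<mu> E0 H0 t_end = (\<lambda>w. idft3 G *\<^sub>v Et w)"
    "scheme_H G \<epsilon> \<mu> E0 H0 t_end = (\<lambda>w. idft3 G *\<^sub>v Ht w)"
    unfolding Et_def Ht_def Eh_def Hh_def
    by (intro scheme_E_eq scheme_H_eq assms(1,2) carr)+
  have "?q * ?r = 1" using assms(1,2) by simp
  then have flux: "Im (mode_flux Ht Et p) = Im (mode_flux Hh Eh p)" if "p < total_pts G" for p
    unfolding Et_def Ht_def by (rule Im_mode_flux_spectral[OF that])
  \<comment> \<open>This reduces the second momentum to the flux already known to be
    conserved.\<close>
  have swap: "Im (mode_flux u v p) = - Im (mode_flux v u p)" for u v p
    unfolding mode_flux_def by (rule Im_flux_swap)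
  note inner = inner_N_diff_op[OF assms(4-6)]
  have "momentum1 G k (\<lambda>w. idft3 G *\<^sub>v Et w) (\<lambda>w. idft3 G *\<^sub>v Ht w)
      = momentum1 G k (\<lambda>w. idft3 G *\<^sub>v Eh w) (\<lambda>w. idft3 G *\<^sub>v Hh w)"
    unfolding momentum1_def inner[OF sym(2,1)] inner[OF sym0(2,1)] by (simp add: flux)
  moreover have "momentum2 G k (\<lambda>w. idft3 G *\<^sub>v Et w) (\<lambda>w. idft3 G *\<^sub>v Ht w)
      = momentum2 G k (\<lambda>w. idft3 G *\<^sub>v Eh w) (\<lambda>w. idft3 G *\<^sub>v Hh w)"
    unfolding momentum2_def inner[OF sym(1,2)] inner[OF sym0(1,2)]
    by (simp add: swap[of Et] swap[of Eh] flux)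
  ultimately show ?thesis
    unfolding final init[symmetric] by blast
qed

end
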